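(* Let $A,B>0$ be bounded linear operators on a Hilbert space $\mathcal{H}$ such that $sA\le B\le tA$ for some scalars $0<s\le t$, and let $v\in[0,1]$. Then $$A\nabla_v B-A\sharp_v B\le \max\{g_v(s),g_v(t)\}\,A,$$ where $g_v(x)=(1-v)+vx-x^v$ for $s\le x\le t$.
   Context: Operators are bounded linear operators on a Hilbert space $\mathcal{H}$. $A\ge 0$ (positive) means $\langle Ax,x\rangle\ge 0$ for all $x\in\mathcal{H}$; $A>0$ (strictly positive) means $A$ is positive and invertible; for self-adjoint $A,B$, $A\le B$ means $B-A\ge 0$. For $A,B>0$ and $v\in[0,1]$: $A\nabla_v B=(1-v)A+vB$ and $A\sharp_v B=A^{1/2}\left(A^{-1/2}BA^{-1/2}\right)^v A^{1/2}$, with powers defined by the continuous functional calculus. *)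

theory Defs
  imports "HOL-Analysis.Analysis"
begin

text \<open>
  Complex Hilbert spaces. The real inner product and the norm of the underlying
  real structure are tied to the complex inner product by the axiom
  \<open>inner_eq_Re_cinner\<close>; in particular \<open>norm x = sqrt (Re (cinner x x))\<close>, and positive
  definiteness of \<open>cinner\<close> comes from that of \<open>inner\<close>.
  The complex inner product is linear in its first argument.
\<close>

class complex_inner = real_inner +
  fixes scaleC :: "complex \<Rightarrow> 'a \<Rightarrow> 'a" (infixr "*\<^sub>C" 75)
    and cinner :: "'a \<Rightarrow> 'a \<Rightarrow> complex"
  assumes scaleC_add_right: "c *\<^sub>C (x + y) = c *\<^sub>C x + c *\<^sub>C y"
    and scaleC_add_left: "(c + d) *\<^sub>C x = c *\<^sub>C x + d *\<^sub>C x"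
    and scaleC_scaleC: "c *\<^sub>C (d *\<^sub>C x) = (c * d) *\<^sub>C x"
    and scaleC_of_real: "complex_of_real r *\<^sub>C x = r *\<^sub>R x"
    and cinner_commute: "cinner x y = cnj (cinner y x)"
    and cinner_add_left: "cinner (x + y) z = cinner x z + cinner y z"
    and cinner_scaleC_left: "cinner (c *\<^sub>C x) y = c * cinner x y"
    and inner_eq_Re_cinner: "inner x y = Re (cinner x y)"

class complex_hilbert_space = complex_inner + complete_space

instantiation complex :: complex_hilbert_space
begin

definition scaleC_complex :: "complex \<Rightarrow> complex \<Rightarrow> complex"
  where "scaleC_complex c x = c * x"

definition cinner_complex :: "complex \<Rightarrow> complex \<Rightarrow> complex"
  where "cinner_complex x y = x * cnj y"

instance
  by standard
    (simp_all add: scaleC_complex_def cinner_complex_def inner_complex_def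
      algebra_simps scaleR_conv_of_real)

end

lemma norm_scaleC: "norm (c *\<^sub>C x) = cmod c * norm (x :: 'a :: complex_inner)"
proof -
  have im: "Im (cinner x x) = 0"
    using arg_cong[OF cinner_commute[of x x], of Im] by simp
  have "cinner (c *\<^sub>C x) (c *\<^sub>C x) = c * cnj (c * cinner x x)"
    by (metis cinner_commute cinner_scaleC_left)
  also have "\<dots> = (c * cnj c) * cnj (cinner x x)"
    by simp
  finally have "Re (cinner (c *\<^sub>C x) (c *\<^sub>C x)) = (cmod c)\<^sup>2 * Re (cinner x x)"
    using im by (simp add: complex_mult_cnj cmod_power2)
  then have "(norm (c *\<^sub>C x))\<^sup>2 = (cmod c * norm x)\<^sup>2"
    by (simp add: power2_norm_eq_inner inner_eq_Re_cinner power_mult_distrib)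
  then show ?thesis
    by (simp add: power2_eq_iff_nonneg)
qed

lemma bounded_linear_scaleC: "bounded_linear (\<lambda>x :: 'a :: complex_inner. c *\<^sub>C x)"
proof (rule bounded_linear_intro[where K = "cmod c"])
  fix r and x :: 'a
  show "c *\<^sub>C (r *\<^sub>R x) = r *\<^sub>R (c *\<^sub>C x)"
    by (metis scaleC_of_real scaleC_scaleC mult.commute)
qed (simp_all add: scaleC_add_right norm_scaleC mult.commute)

text \<open>
  The type \<open>'a \<Rightarrow>\<^sub>L 'a\<close> consists of the bounded real-linear maps; the bounded operators of
  a complex Hilbert space are those of its elements that satisfy \<open>clinear_op\<close>.
\<close>

definition clinear_op :: "('a :: complex_inner \<Rightarrow>\<^sub>L 'a) \<Rightarrow> bool"
  where "clinear_op T \<longleftrightarrow> (\<forall>c x. T (c *\<^sub>C x) = c *\<^sub>C T x)"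

definition invertible_op :: "('a :: complex_inner \<Rightarrow>\<^sub>L 'a) \<Rightarrow> bool"
  where "invertible_op T \<longleftrightarrow>
    (\<exists>S. clinear_op S \<and> S o\<^sub>L T = id_blinfun \<and> T o\<^sub>L S = id_blinfun)"

definition selfadjoint_op :: "('a :: complex_inner \<Rightarrow>\<^sub>L 'a) \<Rightarrow> bool"
  where "selfadjoint_op T \<longleftrightarrow>
    clinear_op T \<and> (\<forall>x y. cinner (T x) y = cinner x (T y))"

definition positive_op :: "('a :: complex_inner \<Rightarrow>\<^sub>L 'a) \<Rightarrow> bool"
  where "positive_op T \<longleftrightarrow> clinear_op T \<and> (\<forall>x. cinner (T x) x \<in> \<real>\<^sub>\<ge>\<^sub>0)"

definition strictly_positive_op :: "('a :: complex_inner \<Rightarrow>\<^sub>L 'a) \<Rightarrow> bool"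
  where "strictly_positive_op T \<longleftrightarrow> positive_op T \<and> invertible_op T"

definition le_op :: "('a :: complex_inner \<Rightarrow>\<^sub>L 'a) \<Rightarrow> ('a \<Rightarrow>\<^sub>L 'a) \<Rightarrow> bool"
    (infix "\<le>\<^sub>o\<^sub>p" 50)
  where "S \<le>\<^sub>o\<^sub>p T \<longleftrightarrow> selfadjoint_op S \<and> selfadjoint_op T \<and> positive_op (T - S)"

lift_definition scalar_op :: "complex \<Rightarrow> 'a :: complex_inner \<Rightarrow>\<^sub>L 'a"
  is "\<lambda>c x. c *\<^sub>C x"
  by (rule bounded_linear_scaleC)

definition spectrum_op :: "('a :: complex_inner \<Rightarrow>\<^sub>L 'a) \<Rightarrow> complex set"
  where "spectrum_op T = {z. \<not> invertible_op (T - scalar_op z)}"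

definition poly_op :: "real poly \<Rightarrow> ('a :: complex_inner \<Rightarrow>\<^sub>L 'a) \<Rightarrow> ('a \<Rightarrow>\<^sub>L 'a)"
  where "poly_op p T = (\<Sum>i\<le>degree p. coeff p i *\<^sub>R (((o\<^sub>L) T ^^ i) id_blinfun))"

text \<open>
  Continuous functional calculus of a self-adjoint operator \<open>T\<close>, whose spectrum is a compact
  set of real numbers, for a real function \<open>f\<close> that is continuous on the spectrum: \<open>f(T)\<close> is
  the limit in operator norm of \<open>p\<^sub>n(T)\<close>, where \<open>p\<^sub>n\<close> are polynomials converging to \<open>f\<close>
  uniformly on the spectrum. The limit does not depend on the choice of the \<open>p\<^sub>n\<close>. The value
  is meaningful only for such \<open>T\<close> and \<open>f\<close>.
\<close>

definition cfc :: "(real \<Rightarrow> real) \<Rightarrow> ('a :: complex_hilbert_space \<Rightarrow>\<^sub>L 'a) \<Rightarrow> ('a \<Rightarrow>\<^sub>L 'a)"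
  where "cfc f T = (THE F. \<exists>p :: nat \<Rightarrow> real poly.
    uniform_limit {x. complex_of_real x \<in> spectrum_op T} (\<lambda>n. poly (p n)) f sequentially \<and>
    (\<lambda>n. poly_op (p n) T) \<longlonglongrightarrow> F)"

definition powr_op :: "('a :: complex_hilbert_space \<Rightarrow>\<^sub>L 'a) \<Rightarrow> real \<Rightarrow> ('a \<Rightarrow>\<^sub>L 'a)"
  where "powr_op T r = cfc (\<lambda>x. x powr r) T"

definition arith_mean_op ::
    "real \<Rightarrow> ('a :: complex_hilbert_space \<Rightarrow>\<^sub>L 'a) \<Rightarrow> ('a \<Rightarrow>\<^sub>L 'a) \<Rightarrow> ('a \<Rightarrow>\<^sub>L 'a)"
  where "arith_mean_op v A B = (1 - v) *\<^sub>R A + v *\<^sub>R B"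

definition geom_mean_op ::
    "real \<Rightarrow> ('a :: complex_hilbert_space \<Rightarrow>\<^sub>L 'a) \<Rightarrow> ('a \<Rightarrow>\<^sub>L 'a) \<Rightarrow> ('a \<Rightarrow>\<^sub>L 'a)"
  where "geom_mean_op v A B =
    powr_op A (1/2) o\<^sub>L
      powr_op (powr_op A (- 1/2) o\<^sub>L B o\<^sub>L powr_op A (- 1/2)) v o\<^sub>L
    powr_op A (1/2)"

definition g_fun :: "real \<Rightarrow> real \<Rightarrow> real"
  where "g_fun v x = (1 - v) + v * x - x powr v"

end

theory Submission
  imports Defs "HOL-Computational_Algebra.Fundamental_Theorem_Algebra"
begin

text \<open>
  Let \<open>R\<close> be the positive square root of \<open>A\<close> and put \<open>T = R\<^sup>-\<^sup>1 B R\<^sup>-\<^sup>1\<close>. Conjugating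
  \<open>s A \<le> B \<le> t A\<close> by \<open>R\<^sup>-\<^sup>1\<close> gives \<open>s \<le> T \<le> t\<close>, so the spectrum of \<open>T\<close> lies in \<open>[s, t]\<close>. The
  function \<open>g\<^sub>v\<close> is convex, hence bounded on \<open>[s, t]\<close> by \<open>m = max (g\<^sub>v(s)) (g\<^sub>v(t))\<close>, and
  therefore \<open>g\<^sub>v(T) \<le> m\<close>. Since \<open>g\<^sub>v(T) = (1 - v) + v T - T\<^sup>v\<close>, conjugating back by \<open>R\<close> turns
  this inequality into the claim.

  Most of the work is to show that the functional calculus of a self-adjoint operator \<open>T\<close> is
  well defined, multiplicative and monotone. Everything rests on the estimate that
  \<open>\<parallel>p(T)\<parallel> < M\<close> for a real polynomial \<open>p\<close> with \<open>\<bar>p\<bar> < M\<close> on the spectrum of \<open>T\<close>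
  (\<open>norm_poly_op_less\<close>). It follows from two facts. A nonzero real polynomial without zeros among
  the real points of the spectrum yields an invertible operator (\<open>invertible_poly_op\<close>): it is
  a product of linear and of irreducible quadratic polynomials, and the latter give coercive
  operators, which are invertible by a contraction argument. On the other hand
  \<open>\<parallel>S\<parallel>\<^sup>2 - S\<^sup>2\<close> is never invertible for a nonzero self-adjoint \<open>S\<close>
  (\<open>norm_square_minus_square_not_invertible\<close>).

  Given the estimate, Weierstrass approximation yields existence of \<open>f(T)\<close>
  (\<open>has_cfc_exists\<close>), differences of approximating polynomials yield uniqueness
  (\<open>has_cfc_unique\<close>), and writing \<open>m - f\<close> as a square yields \<open>f(T) \<le> m\<close> whenever \<open>f \<le> m\<close> on
  an interval containing the spectrum (\<open>has_cfc_upper_bound\<close>).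
\<close>

section \<open>Self-adjoint and positive operators in terms of the real inner product\<close>

instance complex_hilbert_space \<subseteq> banach ..

lemma inner_imaginary_unit_left:
  "inner (\<i> *\<^sub>C x) y = - Im (cinner x y)" for x y :: "'a :: complex_inner"
  by (simp add: inner_eq_Re_cinner cinner_scaleC_left)

text \<open>
  The real inner product determines the complex one on complex-linear operators: the imaginary
  part of \<open>\<langle>x, y\<rangle>\<close> is, up to sign, the real inner product of \<open>\<i> x\<close> and \<open>y\<close>.
\<close>

lemma selfadjoint_op_iff_inner:
  "selfadjoint_op T \<longleftrightarrow> clinear_op T \<and> (\<forall>x y. inner (T x) y = inner x (T y))"
proof safe
  assume T: "selfadjoint_op T"
  then show "clinear_op T"
    by (simp add: selfadjoint_op_def)
  show "inner (T x) y = inner x (T y)" for x y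
    using T by (simp add: selfadjoint_op_def inner_eq_Re_cinner)
next
  assume lin: "clinear_op T" and sym: "\<forall>x y. inner (T x) y = inner x (T y)"
  have "cinner (T x) y = cinner x (T y)" for x y
  proof (rule complex_eqI)
    show "Re (cinner (T x) y) = Re (cinner x (T y))"
      using sym by (simp add: inner_eq_Re_cinner)
    have "inner (\<i> *\<^sub>C T x) y = inner (\<i> *\<^sub>C x) (T y)"
      using lin sym by (metis clinear_op_def)
    then show "Im (cinner (T x) y) = Im (cinner x (T y))"
      by (simp add: inner_imaginary_unit_left)
  qed
  with lin show "selfadjoint_op T"
    by (simp add: selfadjoint_op_def)
qed

lemma selfadjoint_op_clinear: "selfadjoint_op T \<Longrightarrow> clinear_op T"
  by (simp add: selfadjoint_op_def)

lemma selfadjoint_op_inner: "selfadjoint_op T \<Longrightarrow> inner (T x) y = inner x (T y)"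
  by (simp add: selfadjoint_op_iff_inner)

lemma positive_op_iff_inner:
  assumes "selfadjoint_op T"
  shows "positive_op T \<longleftrightarrow> (\<forall>x. 0 \<le> inner (T x) x)"
proof -
  have "cinner (T x) x = cnj (cinner (T x) x)" for x
    using assms by (metis cinner_commute selfadjoint_op_def)
  then have "Im (cinner (T x) x) = 0" for x
    by (metis cnj.simps(2) neg_equal_zero)
  then show ?thesis
    using assms
    by (simp add: positive_op_def selfadjoint_op_def complex_nonneg_Reals_iff inner_eq_Re_cinner)
qed

lemma clinear_op_id: "clinear_op id_blinfun"
  by (simp add: clinear_op_def)

lemma clinear_op_compose: "clinear_op S \<Longrightarrow> clinear_op T \<Longrightarrow> clinear_op (S o\<^sub>L T)"
  by (simp add: clinear_op_def)

lemma scaleC_scaleR_commute: "c *\<^sub>C (r *\<^sub>R x) = r *\<^sub>R (c *\<^sub>C x)" for x :: "'a :: complex_inner"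
  by (metis scaleC_of_real scaleC_scaleC mult.commute)

lemma scaleC_minus_right: "c *\<^sub>C (x - y) = c *\<^sub>C x - c *\<^sub>C y" for x y :: "'a :: complex_inner"
  by (metis add_diff_cancel diff_add_cancel scaleC_add_right)

lemma clinear_op_add: "clinear_op S \<Longrightarrow> clinear_op T \<Longrightarrow> clinear_op (S + T)"
  by (simp add: clinear_op_def blinfun.add_left scaleC_add_right)

lemma clinear_op_diff: "clinear_op S \<Longrightarrow> clinear_op T \<Longrightarrow> clinear_op (S - T)"
  by (simp add: clinear_op_def blinfun.diff_left scaleC_minus_right)

lemma clinear_op_scaleR: "clinear_op T \<Longrightarrow> clinear_op (r *\<^sub>R T)"
  by (simp add: clinear_op_def blinfun.scaleR_left scaleC_scaleR_commute)

lemma selfadjoint_op_id: "selfadjoint_op id_blinfun"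
  by (simp add: selfadjoint_op_def clinear_op_id)

lemma selfadjoint_op_add: "selfadjoint_op S \<Longrightarrow> selfadjoint_op T \<Longrightarrow> selfadjoint_op (S + T)"
  by (simp add: selfadjoint_op_iff_inner clinear_op_add blinfun.add_left inner_add_left
      inner_add_right)

lemma selfadjoint_op_diff: "selfadjoint_op S \<Longrightarrow> selfadjoint_op T \<Longrightarrow> selfadjoint_op (S - T)"
  by (simp add: selfadjoint_op_iff_inner clinear_op_diff blinfun.diff_left inner_diff_left
      inner_diff_right)

lemma selfadjoint_op_scaleR: "selfadjoint_op T \<Longrightarrow> selfadjoint_op (r *\<^sub>R T)"
  by (simp add: selfadjoint_op_iff_inner clinear_op_scaleR blinfun.scaleR_left)

lemma selfadjoint_op_conjugate:
  "selfadjoint_op S \<Longrightarrow> selfadjoint_op T \<Longrightarrow> selfadjoint_op (S o\<^sub>L T o\<^sub>L S)"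
  by (simp add: selfadjoint_op_iff_inner clinear_op_compose)

lemma selfadjoint_op_limit:
  assumes "\<And>n. selfadjoint_op (X n)" and "X \<longlonglongrightarrow> T"
  shows "selfadjoint_op T"
proof -
  have lim: "(\<lambda>n. X n x) \<longlonglongrightarrow> T x" for x
    using assms(2) by (intro tendsto_intros)
  have "T (c *\<^sub>C x) = c *\<^sub>C T x" for c x
  proof (rule LIMSEQ_unique)
    show "(\<lambda>n. X n (c *\<^sub>C x)) \<longlonglongrightarrow> T (c *\<^sub>C x)"
      by (rule lim)
    show "(\<lambda>n. X n (c *\<^sub>C x)) \<longlonglongrightarrow> c *\<^sub>C T x"
      using bounded_linear.tendsto[OF bounded_linear_scaleC lim] assms(1)
      by (simp add: selfadjoint_op_def clinear_op_def)
  qed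
  moreover have "inner (T x) y = inner x (T y)" for x y
  proof (rule LIMSEQ_unique)
    show "(\<lambda>n. inner (X n x) y) \<longlonglongrightarrow> inner (T x) y"
      by (intro tendsto_intros lim)
    have "(\<lambda>n. inner x (X n y)) \<longlonglongrightarrow> inner x (T y)"
      by (intro tendsto_intros lim)
    then show "(\<lambda>n. inner (X n x) y) \<longlonglongrightarrow> inner x (T y)"
      using assms(1) by (simp add: selfadjoint_op_inner)
  qed
  ultimately show ?thesis
    by (simp add: selfadjoint_op_iff_inner clinear_op_def)
qed

section \<open>Invertibility\<close>

lemma invertible_op_bounded_below:
  assumes "invertible_op T"
  obtains c where "c > 0" and "\<And>x. c * norm x \<le> norm (T x)"
proof -
  obtain S where S: "S o\<^sub>L T = id_blinfun"
    using assms by (auto simp: invertible_op_def)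
  have "norm x \<le> (norm S + 1) * norm (T x)" for x
  proof -
    have "norm x = norm (S (T x))"
      using arg_cong[OF S, of "\<lambda>F. blinfun_apply F x"] by simp
    also have "\<dots> \<le> norm S * norm (T x)"
      by (rule norm_blinfun)
    also have "\<dots> \<le> (norm S + 1) * norm (T x)"
      by (simp add: mult_right_mono)
    finally show ?thesis .
  qed
  moreover have "norm S + 1 > 0"
    by (simp add: add_nonneg_pos)
  ultimately show thesis
    by (intro that[of "1 / (norm S + 1)"]) (simp_all add: field_simps)
qed

lemma invertible_op_if_bounded_below_surj:
  assumes lin: "clinear_op T" and c: "c > 0" and below: "\<And>x. c * norm x \<le> norm (T x)"
    and surj: "surj T"
  shows "invertible_op T"
proof -
  have inj: "x = y" if "T x = T y" for x y
    using below[of "x - y"] c that by (simp add: blinfun.diff_right mult_le_0_iff)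
  define g where "g = inv T"
  have Tg: "T (g y) = y" for y
    unfolding g_def using surj by (simp add: surj_f_inv_f)
  have gT: "g (T x) = x" for x
    by (rule inj) (simp add: Tg)
  have "bounded_linear g"
  proof (rule bounded_linear_intro[where K = "1 / c"])
    show "g (x + y) = g x + g y" for x y
      by (rule inj) (simp add: Tg blinfun.add_right)
    show "g (r *\<^sub>R x) = r *\<^sub>R g x" for r x
      by (rule inj) (simp add: Tg blinfun.scaleR_right)
    show "norm (g x) \<le> norm x * (1 / c)" for x
      using below[of "g x"] c by (simp add: Tg field_simps)
  qed
  then have app: "blinfun_apply (Blinfun g) = g"
    by (rule bounded_linear_Blinfun_apply)
  have "clinear_op (Blinfun g)"
    unfolding clinear_op_def app
  proof (intro allI)
    show "g (a *\<^sub>C x) = a *\<^sub>C g x" for a x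
      by (rule inj) (use lin in \<open>simp add: Tg clinear_op_def\<close>)
  qed
  moreover have "Blinfun g o\<^sub>L T = id_blinfun" "T o\<^sub>L Blinfun g = id_blinfun"
    by (auto intro!: blinfun_eqI simp: app Tg gT)
  ultimately show ?thesis
    unfolding invertible_op_def by blast
qed

text \<open>
  A Lax--Milgram argument: for a small step size \<open>\<tau>\<close> the map \<open>x \<mapsto> x - \<tau> (T x - y)\<close> is a
  contraction, and its fixed point solves \<open>T x = y\<close>.
\<close>

lemma invertible_op_if_coercive:
  fixes T :: "'a :: complex_hilbert_space \<Rightarrow>\<^sub>L 'a"
  assumes lin: "clinear_op T" and c: "c > 0"
    and coercive: "\<And>x. c * (norm x)\<^sup>2 \<le> inner (T x) x"
  shows "invertible_op T"
proof (rule invertible_op_if_bounded_below_surj[OF lin c])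
  fix x
  have "c * (norm x)\<^sup>2 \<le> norm (T x) * norm x"
    using coercive[of x] norm_cauchy_schwarz[of "T x" x] by linarith
  then show "c * norm x \<le> norm (T x)"
    by (cases "x = 0") (simp_all add: power2_eq_square flip: mult.assoc)
next
  define M where "M = norm T + c"
  define \<tau> where "\<tau> = c / M\<^sup>2"
  have M: "0 < M" "c \<le> M" "norm T \<le> M"
    using c by (simp_all add: M_def add_nonneg_pos)
  have \<tau>: "\<tau> > 0"
    using c M by (simp add: \<tau>_def)
  have "c\<^sup>2 \<le> M\<^sup>2"
    using c M by (simp add: power_mono)
  then have frac: "0 \<le> 1 - c\<^sup>2 / M\<^sup>2"
    using M by (simp add: field_simps)
  define q where "q = sqrt (1 - c\<^sup>2 / M\<^sup>2)"
  have q: "0 \<le> q" "q < 1" "q\<^sup>2 = 1 - c\<^sup>2 / M\<^sup>2"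
    using c M frac by (simp_all add: q_def)
  have contraction: "norm (x - \<tau> *\<^sub>R T x) \<le> q * norm x" for x
  proof -
    have "norm (T x) \<le> M * norm x"
      using norm_blinfun[of T x] M(3) by (meson mult_right_mono norm_ge_zero order_trans)
    then have "(norm (T x))\<^sup>2 \<le> M\<^sup>2 * (norm x)\<^sup>2"
      by (metis norm_ge_zero power_mono power_mult_distrib)
    then have T: "\<tau>\<^sup>2 * (norm (T x))\<^sup>2 \<le> \<tau>\<^sup>2 * (M\<^sup>2 * (norm x)\<^sup>2)"
      by (simp add: mult_left_mono)
    have "2 * \<tau> * (c * (norm x)\<^sup>2) \<le> 2 * \<tau> * inner (T x) x"
      using coercive \<tau> by (simp add: mult_left_mono)
    moreover have "(norm (x - \<tau> *\<^sub>R T x))\<^sup>2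
        = (norm x)\<^sup>2 - 2 * \<tau> * inner (T x) x + \<tau>\<^sup>2 * (norm (T x))\<^sup>2"
      unfolding power2_norm_eq_inner
      by (simp add: inner_diff_left inner_diff_right inner_commute power2_eq_square algebra_simps)
    ultimately have "(norm (x - \<tau> *\<^sub>R T x))\<^sup>2
        \<le> (norm x)\<^sup>2 - 2 * \<tau> * (c * (norm x)\<^sup>2) + \<tau>\<^sup>2 * (M\<^sup>2 * (norm x)\<^sup>2)"
      using T by linarith
    also have "\<dots> = (1 - 2 * (\<tau> * c) + \<tau>\<^sup>2 * M\<^sup>2) * (norm x)\<^sup>2"
      by (simp add: algebra_simps)
    also have "1 - 2 * (\<tau> * c) + \<tau>\<^sup>2 * M\<^sup>2 = q\<^sup>2"
      using M unfolding q(3) by (simp add: \<tau>_def power2_eq_square)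
    finally have "(norm (x - \<tau> *\<^sub>R T x))\<^sup>2 \<le> (q * norm x)\<^sup>2"
      by (simp add: power_mult_distrib)
    then show ?thesis
      by (rule power2_le_imp_le) (simp add: q(1))
  qed
  show "surj T"
  proof (rule surjI)
    fix y
    define f where "f x = x - \<tau> *\<^sub>R (T x - y)" for x
    have "f x - f z = (x - z) - \<tau> *\<^sub>R T (x - z)" for x z
      by (simp add: f_def blinfun.diff_right algebra_simps)
    then have "\<forall>x z. dist (f x) (f z) \<le> q * dist x z"
      using contraction by (simp add: dist_norm)
    then have "\<exists>!x. f x = x"
      using q by (intro banach_fix_type) auto
    then have "\<exists>x. T x = y"
      using \<tau> by (auto simp: f_def)
    then show "T (SOME x. T x = y) = y"
      by (rule someI_ex)
  qed
qed

lemma invertible_op_compose: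
  assumes "invertible_op S" and "invertible_op T"
  shows "invertible_op (S o\<^sub>L T)"
proof -
  obtain S' T' where inv: "clinear_op S'" "clinear_op T'"
    "S' o\<^sub>L S = id_blinfun" "S o\<^sub>L S' = id_blinfun" "T' o\<^sub>L T = id_blinfun" "T o\<^sub>L T' = id_blinfun"
    using assms by (auto simp: invertible_op_def)
  have "S' (S x) = x" "S (S' x) = x" "T' (T x) = x" "T (T' x) = x" for x
    using inv(3-6) by (metis blinfun_apply_blinfun_compose id_blinfun.rep_eq id_apply)+
  then have "(T' o\<^sub>L S') o\<^sub>L (S o\<^sub>L T) = id_blinfun" "(S o\<^sub>L T) o\<^sub>L (T' o\<^sub>L S') = id_blinfun"
    by (auto intro!: blinfun_eqI)
  then show ?thesis
    unfolding invertible_op_def using clinear_op_compose[OF inv(2,1)] by blast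
qed

lemma invertible_op_uminus:
  assumes "invertible_op T"
  shows "invertible_op (- T)"
proof -
  obtain S where S: "clinear_op S" "S o\<^sub>L T = id_blinfun" "T o\<^sub>L S = id_blinfun"
    using assms by (auto simp: invertible_op_def)
  have "(- S) o\<^sub>L (- T) = S o\<^sub>L T" "(- T) o\<^sub>L (- S) = T o\<^sub>L S"
    by (auto intro!: blinfun_eqI simp: blinfun.minus_left blinfun.minus_right)
  moreover have "clinear_op (- S)"
    using clinear_op_scaleR[OF S(1), of "- 1"] by simp
  ultimately show ?thesis
    unfolding invertible_op_def using S by metis
qed

text \<open>
  With \<open>N = norm S\<close>, the identity \<open>\<parallel>(N\<^sup>2 - S\<^sup>2) x\<parallel>\<^sup>2 = N\<^sup>4 \<parallel>x\<parallel>\<^sup>2 - 2 N\<^sup>2 \<parallel>S x\<parallel>\<^sup>2 + \<parallel>S\<^sup>2 x\<parallel>\<^sup>2\<close> shows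
  that a positive lower bound for \<open>N\<^sup>2 - S\<^sup>2\<close> would make the norm of \<open>S\<close> smaller than \<open>N\<close>.
  In other words, \<open>N\<close> or \<open>-N\<close> belongs to the spectrum of \<open>S\<close>.
\<close>

lemma norm_square_minus_square_not_invertible:
  assumes S: "selfadjoint_op S" and N: "norm S > 0"
  shows "\<not> invertible_op ((norm S)\<^sup>2 *\<^sub>R id_blinfun - (S o\<^sub>L S))"
proof
  let ?N = "norm S"
  assume "invertible_op (?N\<^sup>2 *\<^sub>R id_blinfun - (S o\<^sub>L S))"
  then obtain c where c: "c > 0"
    and "\<And>x. c * norm x \<le> norm ((?N\<^sup>2 *\<^sub>R id_blinfun - (S o\<^sub>L S)) x)"
    by (rule invertible_op_bounded_below) blast
  then have below: "c * norm x \<le> norm (?N\<^sup>2 *\<^sub>R x - S (S x))" for x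
    by (simp add: blinfun.diff_left blinfun.scaleR_left)
  define k where "k = max 0 (?N\<^sup>2 - c\<^sup>2 / ?N\<^sup>2)"
  have k: "0 \<le> k" "k < ?N\<^sup>2"
    using c N by (simp_all add: k_def)
  have "norm (S x) \<le> sqrt k * norm x" for x
  proof -
    have "(c * norm x)\<^sup>2 \<le> (norm (?N\<^sup>2 *\<^sub>R x - S (S x)))\<^sup>2"
      using below[of x] c by (intro power_mono) simp_all
    also have "\<dots> = ?N^4 * (norm x)\<^sup>2 - 2 * ?N\<^sup>2 * inner (S (S x)) x + (norm (S (S x)))\<^sup>2"
      unfolding power2_norm_eq_inner
      by (simp add: inner_diff_left inner_diff_right inner_commute algebra_simps
          power2_eq_square power4_eq_xxxx)
    also have "inner (S (S x)) x = (norm (S x))\<^sup>2"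
      by (simp add: selfadjoint_op_inner[OF S] power2_norm_eq_inner)
    also have "(norm (S (S x)))\<^sup>2 \<le> (?N * norm (S x))\<^sup>2"
      by (intro power_mono norm_blinfun) simp
    finally have "c\<^sup>2 * (norm x)\<^sup>2 \<le> ?N^4 * (norm x)\<^sup>2 - ?N\<^sup>2 * (norm (S x))\<^sup>2"
      by (simp add: power_mult_distrib algebra_simps)
    also have "?N^4 = ?N\<^sup>2 * ?N\<^sup>2"
      by (simp add: power2_eq_square power4_eq_xxxx)
    finally have "?N\<^sup>2 * (norm (S x))\<^sup>2 \<le> (?N\<^sup>2 * ?N\<^sup>2 - c\<^sup>2) * (norm x)\<^sup>2"
      by (simp add: algebra_simps)
    then have "(norm (S x))\<^sup>2 \<le> (?N\<^sup>2 - c\<^sup>2 / ?N\<^sup>2) * (norm x)\<^sup>2"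
      using N by (simp add: field_simps power2_eq_square)
    also have "\<dots> \<le> k * (norm x)\<^sup>2"
      by (simp add: k_def mult_right_mono)
    finally have "(norm (S x))\<^sup>2 \<le> (sqrt k * norm x)\<^sup>2"
      using k by (simp add: power_mult_distrib)
    then show ?thesis
      by (rule power2_le_imp_le) (simp add: k(1))
  qed
  then have "?N \<le> sqrt k"
    using k by (intro norm_blinfun_bound) simp_all
  moreover have "sqrt k < ?N"
    using k N by (simp add: real_less_lsqrt)
  ultimately show False
    by simp
qed

section \<open>Polynomials of a self-adjoint operator\<close>

lemma poly_op_0: "poly_op 0 T = 0"
  by (simp add: poly_op_def)

lemma poly_op_pCons: "poly_op (pCons a p) T = a *\<^sub>R id_blinfun + (T o\<^sub>L poly_op p T)"
proof (cases "p = 0")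
  case True
  then show ?thesis
    by (simp add: poly_op_def)
next
  case False
  \<comment> \<open>For \<open>p \<noteq> 0\<close> the degree goes up by exactly one, so the sums match term by term.\<close>
  have "poly_op (pCons a p) T
      = (\<Sum>i\<le>Suc (degree p). coeff (pCons a p) i *\<^sub>R (((o\<^sub>L) T ^^ i) id_blinfun))"
    using False by (simp add: poly_op_def)
  also have "\<dots> = a *\<^sub>R id_blinfun
      + (\<Sum>i\<le>degree p. coeff p i *\<^sub>R (T o\<^sub>L ((o\<^sub>L) T ^^ i) id_blinfun))"
    by (subst sum.atMost_Suc_shift) simp
  also have "(\<Sum>i\<le>degree p. coeff p i *\<^sub>R (T o\<^sub>L ((o\<^sub>L) T ^^ i) id_blinfun)) = T o\<^sub>L poly_op p T"
    unfolding poly_op_def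
    by (simp add: bounded_bilinear.sum_right[OF bounded_bilinear_blinfun_compose]
        bounded_bilinear.scaleR_right[OF bounded_bilinear_blinfun_compose])
  finally show ?thesis .
qed

lemma poly_op_add: "poly_op (p + q) T = poly_op p T + poly_op q T"
  by (induction p q rule: poly_induct2)
    (simp_all add: poly_op_0 poly_op_pCons scaleR_add_left
      bounded_bilinear.add_right[OF bounded_bilinear_blinfun_compose])

lemma poly_op_smult: "poly_op (smult c p) T = c *\<^sub>R poly_op p T"
  by (induction p)
    (simp_all add: poly_op_0 poly_op_pCons scaleR_add_right
      bounded_bilinear.scaleR_right[OF bounded_bilinear_blinfun_compose])

lemma poly_op_diff: "poly_op (p - q) T = poly_op p T - poly_op q T"
proof -
  have "p - q = p + smult (-1) q"
    by simp
  then show ?thesis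
    by (simp only: poly_op_add poly_op_smult) simp
qed

lemma poly_op_const: "poly_op [:c:] T = c *\<^sub>R id_blinfun"
  by (simp add: poly_op_pCons poly_op_0)

lemma blinfun_compose_id [simp]: "T o\<^sub>L id_blinfun = T" "id_blinfun o\<^sub>L T = T"
  by (auto intro: blinfun_eqI)

lemma poly_op_linear: "poly_op [:c, 1:] T = c *\<^sub>R id_blinfun + T"
  by (simp add: poly_op_pCons poly_op_0)

lemma poly_op_mult: "poly_op (p * q) T = poly_op p T o\<^sub>L poly_op q T"
proof (induction p)
  case 0
  then show ?case
    by (simp add: poly_op_0)
next
  case (pCons a p)
  have "poly_op (pCons a p * q) T = a *\<^sub>R poly_op q T + (T o\<^sub>L (poly_op p T o\<^sub>L poly_op q T))"
    by (simp add: poly_op_add poly_op_smult poly_op_pCons pCons.IH)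
  also have "\<dots> = poly_op (pCons a p) T o\<^sub>L poly_op q T"
    by (intro blinfun_eqI) (simp add: poly_op_pCons blinfun.add_left blinfun.scaleR_left)
  finally show ?case .
qed

lemma poly_op_commute: "T o\<^sub>L poly_op p T = poly_op p T o\<^sub>L T"
  using poly_op_mult[of "[:0, 1:]" p T] poly_op_mult[of p "[:0, 1:]" T]
  by (simp add: poly_op_linear mult.commute)

lemma selfadjoint_poly_op:
  assumes "selfadjoint_op T"
  shows "selfadjoint_op (poly_op p T)"
proof (induction p)
  case 0
  then show ?case
    by (simp add: poly_op_0 selfadjoint_op_def clinear_op_def)
      (metis cinner_scaleC_left cinner_commute diff_self mult_zero_left scaleC_minus_right)
next
  case (pCons a p)
  have "inner (T (poly_op p T x)) y = inner x (T (poly_op p T y))" for x y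
    using selfadjoint_op_inner[OF assms] selfadjoint_op_inner[OF pCons.IH]
      arg_cong[OF poly_op_commute, of "\<lambda>F. blinfun_apply F y" T p] by simp
  then have "selfadjoint_op (T o\<^sub>L poly_op p T)"
    using assms pCons.IH by (simp add: selfadjoint_op_iff_inner clinear_op_compose)
  then show ?case
    by (simp add: poly_op_pCons selfadjoint_op_add selfadjoint_op_scaleR selfadjoint_op_id)
qed

abbreviation real_spectrum :: "('a :: complex_inner \<Rightarrow>\<^sub>L 'a) \<Rightarrow> real set"
  where "real_spectrum T \<equiv> {x. complex_of_real x \<in> spectrum_op T}"

lemma real_spectrum_iff: "x \<in> real_spectrum T \<longleftrightarrow> \<not> invertible_op (T - x *\<^sub>R id_blinfun)"
proof -
  have "scalar_op (complex_of_real x) = (x *\<^sub>R id_blinfun :: 'a \<Rightarrow>\<^sub>L 'a)"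
    by (intro blinfun_eqI) (simp add: scalar_op.rep_eq scaleC_of_real blinfun.scaleR_left)
  then show ?thesis
    by (simp add: spectrum_op_def)
qed

lemma poly_complex_of_real_mult:
  "poly (map_poly complex_of_real (p * q)) z
    = poly (map_poly complex_of_real p) z * poly (map_poly complex_of_real q) z"
  and poly_complex_of_real_add:
  "poly (map_poly complex_of_real (p + q)) z
    = poly (map_poly complex_of_real p) z + poly (map_poly complex_of_real q) z"
proof -
  show add: "poly (map_poly complex_of_real (p + q)) z
    = poly (map_poly complex_of_real p) z + poly (map_poly complex_of_real q) z" for p q
    by (induction p q rule: poly_induct2) (simp_all add: map_poly_pCons algebra_simps)
  have smult: "poly (map_poly complex_of_real (smult c p)) z
    = complex_of_real c * poly (map_poly complex_of_real p) z" for c p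
    by (induction p) (simp_all add: map_poly_pCons algebra_simps)
  show "poly (map_poly complex_of_real (p * q)) z
    = poly (map_poly complex_of_real p) z * poly (map_poly complex_of_real q) z"
    by (induction p) (simp_all add: map_poly_pCons algebra_simps add smult)
qed

text \<open>
  A complex root \<open>z\<close> of \<open>p\<close> gives a factor: \<open>X - z\<close> if \<open>z\<close> is real, and otherwise
  \<open>(X - Re z)\<^sup>2 + (Im z)\<^sup>2\<close>, because the remainder modulo this quadratic is a real polynomial of
  degree at most one that vanishes at the non-real number \<open>z\<close>.
\<close>

lemma real_poly_factor:
  fixes p :: "real poly"
  assumes "degree p > 0"
  obtains (linear) a q where "p = [:-a, 1:] * q"
  | (quadratic) a b q where "b \<noteq> 0" "p = ([:-a, 1:] * [:-a, 1:] + [:b\<^sup>2:]) * q"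
proof -
  have "degree (map_poly complex_of_real p) > 0"
    using assms by (simp add: degree_map_poly)
  then have "\<exists>z. poly (map_poly complex_of_real p) z = 0"
    by (intro fundamental_theorem_of_algebra) (simp add: constant_degree)
  then obtain z where z: "poly (map_poly complex_of_real p) z = 0" ..
  show thesis
  proof (cases "Im z = 0")
    case True
    then have "poly (map_poly complex_of_real p) z = complex_of_real (poly p (Re z))"
      by (induction p) (simp_all add: map_poly_pCons complex_eq_iff)
    then have "poly p (Re z) = 0"
      using z by simp
    then show thesis
      using linear by (auto simp: poly_eq_0_iff_dvd dvd_def)
  next
    case False
    define d where "d = [:- Re z, 1:] * [:- Re z, 1:] + [:(Im z)\<^sup>2:]"
    have d: "poly (map_poly complex_of_real d) z = 0"
      by (simp add: d_def map_poly_pCons complex_eq_iff power2_eq_square algebra_simps)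
    have deg: "degree d = 2"
      by (simp add: d_def)
    then have "d \<noteq> 0"
      by auto
    then have "degree (p mod d) < 2"
      using degree_mod_less'[of d p] deg by (cases "p mod d = 0") auto
    then obtain u v where uv: "p mod d = [:u, v:]"
      by (metis degree_pCons_eq degree_eq_zeroE less_2_cases_iff One_nat_def Suc_inject
          pCons_0_0 pCons_cases)
    have "poly (map_poly complex_of_real (p div d * d + p mod d)) z = 0"
      using z by simp
    then have "poly (map_poly complex_of_real (p mod d)) z = 0"
      unfolding poly_complex_of_real_add poly_complex_of_real_mult d by simp
    then have "u = 0 \<and> v = 0"
      using False by (auto simp: uv map_poly_pCons complex_eq_iff)
    then have "p = d * (p div d)"
      using uv div_mult_mod_eq[of p d] by (simp add: mult.commute)
    then show thesis
      using False quadratic unfolding d_def by blast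
  qed
qed

text \<open>
  This is the part of the spectral mapping theorem that the norm estimate needs. A linear factor \<open>X - a\<close> with
  \<open>a\<close> outside the spectrum is invertible by definition, and an irreducible quadratic factor
  \<open>(X - a)\<^sup>2 + b\<^sup>2\<close> gives the coercive operator \<open>(T - a)\<^sup>2 + b\<^sup>2\<close>.
\<close>

lemma invertible_poly_op:
  fixes T :: "'a :: complex_hilbert_space \<Rightarrow>\<^sub>L 'a"
  assumes T: "selfadjoint_op T" and "p \<noteq> 0" and "\<And>x. x \<in> real_spectrum T \<Longrightarrow> poly p x \<noteq> 0"
  shows "invertible_op (poly_op p T)"
  using assms(2,3)
proof (induction "degree p" arbitrary: p rule: less_induct)
  case less
  show ?case
  proof (cases "degree p = 0")
    case True
    then obtain c where p: "p = [:c:]"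
      by (rule degree_eq_zeroE)
    with less.prems have "c \<noteq> 0"
      by simp
    then show ?thesis
      unfolding invertible_op_def p poly_op_const
      by (intro exI[of _ "(1 / c) *\<^sub>R id_blinfun"])
        (auto intro!: blinfun_eqI clinear_op_scaleR clinear_op_id simp: blinfun.scaleR_left)
  next
    case False
    then have "degree p > 0"
      by simp
    then show ?thesis
    proof (cases rule: real_poly_factor)
      case (linear a q)
      have "q \<noteq> 0"
        using linear less.prems by auto
      then have "degree q < degree p"
        by (simp add: linear degree_mult_eq del: mult_pCons_left)
      moreover have "poly q x \<noteq> 0" if "x \<in> real_spectrum T" for x
        using less.prems(2)[OF that] by (simp add: linear)
      ultimately have "invertible_op (poly_op q T)"
        using \<open>q \<noteq> 0\<close> by (intro less.hyps)
      moreover have "poly p a = 0"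
        by (simp add: linear)
      then have "invertible_op (T - a *\<^sub>R id_blinfun)"
        using less.prems(2)[of a] real_spectrum_iff[of a T] by blast
      then have "invertible_op (poly_op [:-a, 1:] T)"
        by (simp add: poly_op_linear)
      ultimately show ?thesis
        unfolding linear poly_op_mult by (intro invertible_op_compose)
    next
      case (quadratic a b q)
      let ?d = "[:-a, 1:] * [:-a, 1:] + [:b\<^sup>2:]"
      have "q \<noteq> 0" "?d \<noteq> 0"
        using quadratic less.prems by auto
      moreover have "degree ?d = 2"
        by simp
      ultimately have "degree q < degree p"
        unfolding quadratic by (subst degree_mult_eq) simp_all
      moreover have "poly q x \<noteq> 0" if "x \<in> real_spectrum T" for x
        using less.prems(2)[OF that] unfolding quadratic poly_mult by auto
      ultimately have "invertible_op (poly_op q T)"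
        using \<open>q \<noteq> 0\<close> by (intro less.hyps)
      moreover have "invertible_op (poly_op ?d T)"
      proof (rule invertible_op_if_coercive)
        show "clinear_op (poly_op ?d T)"
          by (intro selfadjoint_op_clinear selfadjoint_poly_op T)
        show "b\<^sup>2 > 0"
          using quadratic by simp
        let ?L = "poly_op [:-a, 1:] T"
        have L: "selfadjoint_op ?L"
          by (intro selfadjoint_poly_op T)
        have "inner (poly_op ?d T x) x = inner (?L x) (?L x) + b\<^sup>2 * (norm x)\<^sup>2" for x
          unfolding poly_op_add poly_op_mult poly_op_const
          by (simp add: blinfun.add_left blinfun.scaleR_left inner_add_left
              power2_norm_eq_inner selfadjoint_op_inner[OF L])
        then show "b\<^sup>2 * (norm x)\<^sup>2 \<le> inner (poly_op ?d T x) x" for x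
          by simp
      qed
      ultimately show ?thesis
        unfolding quadratic poly_op_mult by (intro invertible_op_compose)
    qed
  qed
qed

text \<open>
  The proof of the norm estimate applies \<open>invertible_poly_op\<close> to \<open>N\<^sup>2 - p\<^sup>2\<close>, which vanishes
  identically if \<open>p\<close> is one of the constants \<open>N\<close> and \<open>-N\<close>. A point of the spectrum excludes
  this. It exists because otherwise \<open>\<parallel>T\<parallel>\<^sup>2 - T\<^sup>2\<close> would be invertible, or, for \<open>T = 0\<close>, the zero
  operator.
\<close>

lemma real_spectrum_nonempty:
  fixes T :: "'a :: complex_hilbert_space \<Rightarrow>\<^sub>L 'a"
  assumes T: "selfadjoint_op T" and id: "id_blinfun \<noteq> (0 :: 'a \<Rightarrow>\<^sub>L 'a)"
  shows "real_spectrum T \<noteq> {}"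
proof (cases "T = 0")
  case True
  then have "\<not> invertible_op (T - 0 *\<^sub>R id_blinfun)"
    using id by (simp add: invertible_op_def)
  then have "0 \<in> real_spectrum T"
    using real_spectrum_iff by blast
  then show ?thesis
    by blast
next
  case False
  let ?p = "[:(norm T)\<^sup>2:] - [:0, 1:] * [:0, 1:]"
  have "poly_op ?p T = (norm T)\<^sup>2 *\<^sub>R id_blinfun - (T o\<^sub>L T)"
    unfolding poly_op_diff poly_op_mult poly_op_const poly_op_linear by simp
  then have "\<not> invertible_op (poly_op ?p T)"
    using norm_square_minus_square_not_invertible[OF T] False by simp
  moreover have "?p \<noteq> 0"
    by simp
  ultimately show ?thesis
    using invertible_poly_op[OF T, of ?p] by blast
qed

text \<open>
  If \<open>N = \<parallel>p(T)\<parallel>\<close> were at least \<open>M\<close>, the polynomial \<open>N\<^sup>2 - p\<^sup>2\<close> would be positive on the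
  spectrum, so that \<open>N\<^sup>2 - p(T)\<^sup>2\<close> would be invertible. Requiring \<open>M > 0\<close> covers an empty
  spectrum, which occurs on the zero space.
\<close>

lemma norm_poly_op_less:
  fixes T :: "'a :: complex_hilbert_space \<Rightarrow>\<^sub>L 'a"
  assumes T: "selfadjoint_op T" and M: "M > 0"
    and p: "\<And>x. x \<in> real_spectrum T \<Longrightarrow> \<bar>poly p x\<bar> < M"
  shows "norm (poly_op p T) < M"
proof (rule ccontr)
  let ?S = "poly_op p T"
  let ?q = "[:(norm ?S)\<^sup>2:] - p * p"
  assume "\<not> norm ?S < M"
  with M have N: "M \<le> norm ?S" "0 < norm ?S"
    by linarith+
  have pos: "poly ?q x > 0" if "x \<in> real_spectrum T" for x
  proof -
    have "\<bar>poly p x\<bar> < norm ?S"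
      using p[OF that] N by simp
    then have "\<bar>poly p x\<bar>\<^sup>2 < (norm ?S)\<^sup>2"
      by (intro power_strict_mono) simp_all
    then show ?thesis
      by (simp add: power2_eq_square)
  qed
  have "id_blinfun \<noteq> (0 :: 'a \<Rightarrow>\<^sub>L 'a)"
  proof
    assume "id_blinfun = (0 :: 'a \<Rightarrow>\<^sub>L 'a)"
    then have "?S = 0"
      by (metis blinfun_compose_id(1) blinfun_compose_zero(2))
    with N(2) show False
      by simp
  qed
  then obtain x where "x \<in> real_spectrum T"
    using real_spectrum_nonempty[OF T] by blast
  then have "?q \<noteq> 0"
    using pos[of x] by (metis poly_0 less_irrefl)
  moreover have "poly ?q x \<noteq> 0" if "x \<in> real_spectrum T" for x
    using pos[OF that] by linarith
  ultimately have "invertible_op (poly_op ?q T)"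
    by (rule invertible_poly_op[OF T])
  then show False
    using norm_square_minus_square_not_invertible[OF selfadjoint_poly_op[OF T] N(2)]
    by (simp only: poly_op_diff poly_op_mult poly_op_const)
qed

section \<open>The continuous functional calculus\<close>

text \<open>
  The relation says that \<open>F\<close> satisfies the description by which \<^const>\<open>cfc\<close> selects its value.
  Differences and products of approximating polynomials carry over to it directly, without knowing
  first that the described operator exists and is unique.
\<close>

definition has_cfc ::
    "(real \<Rightarrow> real) \<Rightarrow> ('a :: complex_hilbert_space \<Rightarrow>\<^sub>L 'a) \<Rightarrow> ('a \<Rightarrow>\<^sub>L 'a) \<Rightarrow> bool"
  where "has_cfc f T F \<longleftrightarrow> (\<exists>p. uniform_limit (real_spectrum T) (\<lambda>n. poly (p n)) f sequentially \<and>
    (\<lambda>n. poly_op (p n) T) \<longlonglongrightarrow> F)"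

lemma has_cfc_unique:
  assumes T: "selfadjoint_op T" and "has_cfc f T F" and "has_cfc g T G"
    and eq: "\<And>x. x \<in> real_spectrum T \<Longrightarrow> f x = g x"
  shows "F = G"
proof -
  obtain p q where p: "uniform_limit (real_spectrum T) (\<lambda>n. poly (p n)) f sequentially"
    "(\<lambda>n. poly_op (p n) T) \<longlonglongrightarrow> F"
    and q: "uniform_limit (real_spectrum T) (\<lambda>n. poly (q n)) g sequentially"
    "(\<lambda>n. poly_op (q n) T) \<longlonglongrightarrow> G"
    using assms(2,3) by (auto simp: has_cfc_def)
  have unif: "uniform_limit (real_spectrum T) (\<lambda>n x. poly (p n) x - poly (q n) x)
      (\<lambda>x. f x - g x) sequentially"
    using p(1) q(1) by (rule uniform_limit_minus)
  have "(\<lambda>n. poly_op (p n) T - poly_op (q n) T) \<longlonglongrightarrow> 0"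
  proof (rule tendstoI)
    fix e :: real
    assume e: "e > 0"
    have "\<forall>\<^sub>F n in sequentially. \<forall>x\<in>real_spectrum T.
        dist (poly (p n) x - poly (q n) x) (f x - g x) < e"
      using unif e by (rule uniform_limitD)
    then show "\<forall>\<^sub>F n in sequentially. dist (poly_op (p n) T - poly_op (q n) T) 0 < e"
    proof eventually_elim
      case (elim n)
      then have "norm (poly_op (p n - q n) T) < e"
        using e eq by (intro norm_poly_op_less[OF T]) (auto simp: dist_norm)
      then show ?case
        by (simp add: poly_op_diff)
    qed
  qed
  moreover have "(\<lambda>n. poly_op (p n) T - poly_op (q n) T) \<longlonglongrightarrow> F - G"
    using p(2) q(2) by (rule tendsto_diff)
  ultimately have "F - G = 0"
    by (rule LIMSEQ_unique[rotated])
  then show ?thesis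
    by simp
qed

lemma cfc_eqI:
  assumes "selfadjoint_op T" and "has_cfc f T F"
  shows "cfc f T = F"
  unfolding cfc_def has_cfc_def[symmetric]
  using assms by (intro the_equality) (auto intro: has_cfc_unique)

text \<open>
  Weierstrass approximation on the interval yields polynomials, and the norm estimate turns
  their uniform convergence on the spectrum into a Cauchy sequence of operators.
\<close>

lemma has_cfc_exists:
  assumes T: "selfadjoint_op T" and spec: "real_spectrum T \<subseteq> {a..b}"
    and cont: "continuous_on {a..b} f"
  shows "\<exists>F. has_cfc f T F"
proof -
  have "\<exists>p. \<forall>x\<in>{a..b}. \<bar>f x - poly p x\<bar> < e" if e: "e > 0" for e
  proof -
    obtain g where g: "real_polynomial_function g" "\<And>x. x \<in> {a..b} \<Longrightarrow> \<bar>f x - g x\<bar> < e"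
      using Stone_Weierstrass_real_polynomial_function[OF compact_Icc cont e] by blast
    obtain c n where "g = (\<lambda>x. \<Sum>i\<le>n. c i * x ^ i)"
      using g(1) by (auto simp: real_polynomial_function_iff_sum)
    then have "g = poly (\<Sum>i\<le>n. monom (c i) i)"
      by (simp add: fun_eq_iff poly_sum poly_monom)
    then show ?thesis
      using g(2) by blast
  qed
  then have "\<exists>p. \<forall>n. \<forall>x\<in>{a..b}. \<bar>f x - poly (p n) x\<bar> < inverse (real (Suc n))"
    by (intro choice allI) simp
  then obtain p where p: "\<And>n x. x \<in> {a..b} \<Longrightarrow> \<bar>f x - poly (p n) x\<bar> < inverse (real (Suc n))"
    by blast
  have lim: "uniform_limit {a..b} (\<lambda>n. poly (p n)) f sequentially"
  proof (rule uniform_limitI)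
    fix e :: real
    assume "e > 0"
    then have "\<forall>\<^sub>F n in sequentially. inverse (real (Suc n)) < e"
      using LIMSEQ_inverse_real_of_nat by (rule order_tendstoD(2)[rotated])
    then show "\<forall>\<^sub>F n in sequentially. \<forall>x\<in>{a..b}. dist (poly (p n) x) (f x) < e"
    proof eventually_elim
      case (elim n)
      show ?case
        using p[of _ n] elim by (force simp: dist_real_def abs_minus_commute)
    qed
  qed
  then have unif: "uniform_limit (real_spectrum T) (\<lambda>n. poly (p n)) f sequentially"
    using spec by (rule uniform_limit_on_subset)
  have "Cauchy (\<lambda>n. poly_op (p n) T)"
  proof (rule CauchyI)
    fix e :: real
    assume e: "e > 0"
    then obtain N where N: "\<And>n x. n \<ge> N \<Longrightarrow> x \<in> real_spectrum T \<Longrightarrow> dist (poly (p n) x) (f x) < e / 2"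
      using uniform_limitD[OF unif, of "e / 2"] by (auto simp: eventually_sequentially)
    have "norm (poly_op (p m) T - poly_op (p n) T) < e" if "m \<ge> N" "n \<ge> N" for m n
    proof -
      have "\<bar>poly (p m - p n) x\<bar> < e" if "x \<in> real_spectrum T" for x
        using N[OF \<open>m \<ge> N\<close> that] N[OF \<open>n \<ge> N\<close> that]
        unfolding dist_real_def poly_diff by linarith
      then have "norm (poly_op (p m - p n) T) < e"
        using e by (intro norm_poly_op_less[OF T]) auto
      then show ?thesis
        by (simp add: poly_op_diff)
    qed
    then show "\<exists>N. \<forall>m\<ge>N. \<forall>n\<ge>N. norm (poly_op (p m) T - poly_op (p n) T) < e"
      by blast
  qed
  then have "convergent (\<lambda>n. poly_op (p n) T)"
    by (rule Cauchy_convergent)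
  then show ?thesis
    using unif by (auto simp: has_cfc_def convergent_def)
qed

lemma has_cfc_selfadjoint:
  assumes "selfadjoint_op T" and "has_cfc f T F"
  shows "selfadjoint_op F"
  using assms selfadjoint_op_limit[OF selfadjoint_poly_op[OF assms(1)]]
  by (auto simp: has_cfc_def)

lemma has_cfc_poly: "has_cfc (poly p) T (poly_op p T)"
  unfolding has_cfc_def by (intro exI[of _ "\<lambda>_. p"]) (simp add: uniform_limit_iff)

lemma has_cfc_diff:
  assumes "has_cfc f T F" and "has_cfc g T G"
  shows "has_cfc (\<lambda>x. f x - g x) T (F - G)"
proof -
  obtain p q where p: "uniform_limit (real_spectrum T) (\<lambda>n. poly (p n)) f sequentially"
    "(\<lambda>n. poly_op (p n) T) \<longlonglongrightarrow> F"
    and q: "uniform_limit (real_spectrum T) (\<lambda>n. poly (q n)) g sequentially"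
    "(\<lambda>n. poly_op (q n) T) \<longlonglongrightarrow> G"
    using assms by (auto simp: has_cfc_def)
  have "(\<lambda>n. poly (p n - q n)) = (\<lambda>n x. poly (p n) x - poly (q n) x)"
    by (simp add: fun_eq_iff)
  then show ?thesis
    unfolding has_cfc_def
    using uniform_limit_minus[OF p(1) q(1)] tendsto_diff[OF p(2) q(2)]
    by (intro exI[of _ "\<lambda>n. p n - q n"]) (simp add: poly_op_diff)
qed

lemma has_cfc_mult:
  assumes "has_cfc f T F" and "has_cfc g T G"
    and spec: "real_spectrum T \<subseteq> {a..b}"
    and cont: "continuous_on {a..b} f" "continuous_on {a..b} g"
  shows "has_cfc (\<lambda>x. f x * g x) T (F o\<^sub>L G)"
proof -
  obtain p q where p: "uniform_limit (real_spectrum T) (\<lambda>n. poly (p n)) f sequentially"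
    "(\<lambda>n. poly_op (p n) T) \<longlonglongrightarrow> F"
    and q: "uniform_limit (real_spectrum T) (\<lambda>n. poly (q n)) g sequentially"
    "(\<lambda>n. poly_op (q n) T) \<longlonglongrightarrow> G"
    using assms by (auto simp: has_cfc_def)
  have bdd: "bounded (h ` real_spectrum T)" if "continuous_on {a..b} h" for h :: "real \<Rightarrow> real"
    using compact_continuous_image[OF that] spec
    by (metis bounded_subset compact_Icc compact_imp_bounded image_mono)
  have "(\<lambda>n. poly (p n * q n)) = (\<lambda>n x. poly (p n) x * poly (q n) x)"
    by (simp add: fun_eq_iff)
  then show ?thesis
    unfolding has_cfc_def
    using uniform_lim_mult[OF p(1) q(1) bdd[OF cont(1)] bdd[OF cont(2)]]
      bounded_bilinear.tendsto[OF bounded_bilinear_blinfun_compose p(2) q(2)]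
    by (intro exI[of _ "\<lambda>n. p n * q n"]) (simp add: poly_op_mult)
qed

text \<open>
  The operator \<open>m - f(T)\<close> is the square of the self-adjoint operator \<open>h(T)\<close> with
  \<open>h = sqrt (m - f)\<close>.
\<close>

lemma has_cfc_upper_bound:
  assumes T: "selfadjoint_op T" and F: "has_cfc f T F"
    and spec: "real_spectrum T \<subseteq> {a..b}" and cont: "continuous_on {a..b} f"
    and le: "\<And>x. x \<in> {a..b} \<Longrightarrow> f x \<le> m"
  shows "inner (F x) x \<le> m * (norm x)\<^sup>2"
proof -
  define h where "h x = sqrt (m - f x)" for x
  have h: "continuous_on {a..b} h"
    unfolding h_def by (intro continuous_intros cont)
  obtain H where H: "has_cfc h T H"
    using has_cfc_exists[OF T spec h] ..
  have "has_cfc (\<lambda>x. poly [:m:] x - f x) T (poly_op [:m:] T - F)"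
    by (intro has_cfc_diff has_cfc_poly F)
  moreover have "has_cfc (\<lambda>x. h x * h x) T (H o\<^sub>L H)"
    by (intro has_cfc_mult[OF H H spec] h)
  moreover have "poly [:m:] x - f x = h x * h x" if "x \<in> real_spectrum T" for x
    using le[of x] spec that by (auto simp: h_def)
  ultimately have eq: "poly_op [:m:] T - F = H o\<^sub>L H"
    by (rule has_cfc_unique[OF T])
  have "m *\<^sub>R x - F x = H (H x)"
    using arg_cong[OF eq, of "\<lambda>G. blinfun_apply G x"]
    by (simp add: poly_op_const blinfun.diff_left blinfun.scaleR_left)
  then have "m * (norm x)\<^sup>2 - inner (F x) x = inner (H (H x)) x"
    by (metis inner_diff_left inner_scaleR_left power2_norm_eq_inner)
  also have "\<dots> = inner (H x) (H x)"
    using has_cfc_selfadjoint[OF T H] by (rule selfadjoint_op_inner)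
  finally show ?thesis
    using inner_ge_zero[of "H x"] by linarith
qed

text \<open>
  For \<open>l < a\<close> the operator \<open>T - l\<close> is coercive, and for \<open>l > b\<close> the operator \<open>l - T\<close> is.
\<close>

lemma real_spectrum_subset_interval:
  fixes T :: "'a :: complex_hilbert_space \<Rightarrow>\<^sub>L 'a"
  assumes lin: "clinear_op T"
    and lower: "\<And>x. a * (norm x)\<^sup>2 \<le> inner (T x) x"
    and upper: "\<And>x. inner (T x) x \<le> b * (norm x)\<^sup>2"
  shows "real_spectrum T \<subseteq> {a..b}"
proof
  fix l
  assume l: "l \<in> real_spectrum T"
  have quad: "inner ((T - l *\<^sub>R id_blinfun) x) x = inner (T x) x - l * (norm x)\<^sup>2" for x
    by (simp add: blinfun.diff_left blinfun.scaleR_left inner_diff_left power2_norm_eq_inner)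
  have lin_diff: "clinear_op (T - l *\<^sub>R id_blinfun)"
    by (intro clinear_op_diff clinear_op_scaleR clinear_op_id lin)
  have "\<not> l < a"
  proof
    assume "l < a"
    then have "invertible_op (T - l *\<^sub>R id_blinfun)"
      using lower lin_diff
      by (intro invertible_op_if_coercive[where c = "a - l"]) (simp_all add: quad algebra_simps)
    with l show False
      using real_spectrum_iff by blast
  qed
  moreover have "\<not> b < l"
  proof
    assume "b < l"
    have "(l - b) * (norm x)\<^sup>2 \<le> inner ((l *\<^sub>R id_blinfun - T) x) x" for x
      using upper[of x]
      by (simp add: blinfun.diff_left blinfun.scaleR_left inner_diff_left
          left_diff_distrib flip: power2_norm_eq_inner)
    then have "invertible_op (l *\<^sub>R id_blinfun - T)"
      using \<open>b < l\<close> lin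
      by (intro invertible_op_if_coercive[where c = "l - b"] clinear_op_diff clinear_op_scaleR
          clinear_op_id) simp_all
    then have "invertible_op (T - l *\<^sub>R id_blinfun)"
      using invertible_op_uminus by fastforce
    with l show False
      using real_spectrum_iff by blast
  qed
  ultimately show "l \<in> {a..b}"
    by simp
qed

section \<open>The operator inequality\<close>

text \<open>
  Evaluating the nonnegative quadratic form of \<open>A\<close> at \<open>x - A x / \<parallel>A\<parallel>\<close> gives
  \<open>\<parallel>A x\<parallel>\<^sup>2 \<le> \<parallel>A\<parallel> \<langle>A x, x\<rangle>\<close>, and an invertible operator is bounded below.
\<close>

lemma strictly_positive_op_coercive:
  assumes A: "strictly_positive_op A" "selfadjoint_op A"
  obtains a where "a > 0" and "\<And>x. a * (norm x)\<^sup>2 \<le> inner (A x) x"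
proof -
  have pos: "0 \<le> inner (A x) x" for x
    using A by (simp add: strictly_positive_op_def positive_op_iff_inner)
  obtain c where c: "c > 0" "\<And>x. c * norm x \<le> norm (A x)"
    using A invertible_op_bounded_below unfolding strictly_positive_op_def by blast
  \<comment> \<open>The summand 1 keeps the denominator positive on the zero space, where \<open>A = 0\<close>.\<close>
  define M where "M = norm A + 1"
  have M: "M > 0"
    by (simp add: M_def add_nonneg_pos)
  have bound: "(norm (A x))\<^sup>2 / M \<le> inner (A x) x" for x
  proof -
    define y where "y = A x"
    have "norm (A y) \<le> M * norm y"
      using norm_blinfun[of A y] norm_ge_zero[of y] unfolding M_def distrib_right by linarith
    then have "norm (A y) * norm y \<le> M * (norm y)\<^sup>2"
      by (simp add: power2_eq_square mult_right_mono flip: mult.assoc)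
    then have Ay: "inner (A y) y \<le> M * (norm y)\<^sup>2"
      using norm_cauchy_schwarz[of "A y" y] by linarith
    have "inner (A y) x = inner y y"
      using selfadjoint_op_inner[OF A(2), of y x] by (simp add: y_def)
    moreover have "inner (A x) y = inner y y"
      by (simp add: y_def)
    moreover have "0 \<le> inner (A (x - (1 / M) *\<^sub>R y)) (x - (1 / M) *\<^sub>R y)"
      by (rule pos)
    ultimately have "0 \<le> inner (A x) x - 2 * (inner y y / M) + inner (A y) y / M\<^sup>2"
      by (simp add: blinfun.diff_right blinfun.scaleR_right inner_diff_left inner_diff_right
          power2_eq_square diff_divide_distrib)
    also have "inner (A y) y / M\<^sup>2 \<le> inner y y / M"
      using Ay M by (simp add: field_simps power2_eq_square flip: power2_norm_eq_inner)
    finally show ?thesis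
      by (simp add: y_def power2_norm_eq_inner)
  qed
  have "c\<^sup>2 / M * (norm x)\<^sup>2 \<le> inner (A x) x" for x
  proof -
    have "(c * norm x)\<^sup>2 \<le> (norm (A x))\<^sup>2"
      using c by (intro power_mono) simp_all
    then have "c\<^sup>2 / M * (norm x)\<^sup>2 \<le> (norm (A x))\<^sup>2 / M"
      using M by (simp add: power_mult_distrib divide_right_mono)
    with bound[of x] show ?thesis
      by linarith
  qed
  then show thesis
    using c(1) M by (intro that[of "c\<^sup>2 / M"]) simp_all
qed

text \<open>
  The exponents add up because the functional calculus is multiplicative; coercivity keeps the
  spectrum away from 0, where \<open>x powr (- 1/2)\<close> is not continuous.
\<close>

lemma strictly_positive_op_roots:
  fixes A :: "'a :: complex_hilbert_space \<Rightarrow>\<^sub>L 'a"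
  assumes A: "strictly_positive_op A" "selfadjoint_op A"
  shows "selfadjoint_op (powr_op A (1/2))" and "selfadjoint_op (powr_op A (- 1/2))"
    and "powr_op A (1/2) o\<^sub>L powr_op A (1/2) = A"
    and "powr_op A (1/2) o\<^sub>L powr_op A (- 1/2) = id_blinfun"
    and "powr_op A (- 1/2) o\<^sub>L powr_op A (1/2) = id_blinfun"
proof -
  obtain a where a: "a > 0" "\<And>x. a * (norm x)\<^sup>2 \<le> inner (A x) x"
    using strictly_positive_op_coercive[OF A] by blast
  have "inner (A x) x \<le> norm A * (norm x)\<^sup>2" for x
  proof -
    have "inner (A x) x \<le> norm (A x) * norm x"
      by (rule norm_cauchy_schwarz)
    also have "\<dots> \<le> norm A * norm x * norm x"
      by (intro mult_right_mono norm_blinfun norm_ge_zero)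
    finally show ?thesis
      by (simp add: power2_eq_square mult.assoc)
  qed
  then have spec: "real_spectrum A \<subseteq> {a..norm A}"
    using A a by (intro real_spectrum_subset_interval selfadjoint_op_clinear)
  have cont: "continuous_on {a..norm A} (\<lambda>x. x powr r)" for r
    using a by (intro continuous_intros) auto
  have powr: "has_cfc (\<lambda>x. x powr r) A (powr_op A r)" for r
    using has_cfc_exists[OF A(2) spec cont] cfc_eqI[OF A(2)] unfolding powr_op_def by metis
  show "selfadjoint_op (powr_op A (1/2))" "selfadjoint_op (powr_op A (- 1/2))"
    using has_cfc_selfadjoint[OF A(2) powr] by blast+
  have prod: "powr_op A r o\<^sub>L powr_op A r' = poly_op p A"
    if "\<And>x. x > 0 \<Longrightarrow> x powr (r + r') = poly p x" for r r' p
  proof (rule has_cfc_unique[OF A(2) has_cfc_mult[OF powr powr spec cont cont] has_cfc_poly])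
    fix x
    assume "x \<in> real_spectrum A"
    then have "x > 0"
      using spec a by auto
    then show "x powr r * x powr r' = poly p x"
      using that by (simp add: powr_add)
  qed
  have "powr_op A (1/2) o\<^sub>L powr_op A (1/2) = poly_op [:0, 1:] A"
    by (rule prod) simp
  then show "powr_op A (1/2) o\<^sub>L powr_op A (1/2) = A"
    by (simp add: poly_op_linear)
  have "powr_op A (1/2) o\<^sub>L powr_op A (- 1/2) = poly_op [:1:] A"
    "powr_op A (- 1/2) o\<^sub>L powr_op A (1/2) = poly_op [:1:] A"
    by (rule prod; simp)+
  then show "powr_op A (1/2) o\<^sub>L powr_op A (- 1/2) = id_blinfun"
    "powr_op A (- 1/2) o\<^sub>L powr_op A (1/2) = id_blinfun"
    by (simp_all add: poly_op_const)
qed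

lemma g_fun_le_max:
  assumes "0 < s" and "v \<in> {0..1}" and "x \<in> {s..t}"
  shows "g_fun v x \<le> max (g_fun v s) (g_fun v t)"
proof -
  have "convex_on {s..t} (g_fun v)"
  proof (rule f''_ge0_imp_convex)
    show "DERIV (g_fun v) y :> v - v * y powr (v - 1)" if "y \<in> {s..t}" for y
      unfolding g_fun_def[abs_def]
      using that assms(1) by (auto intro!: derivative_eq_intros)
    show "DERIV (\<lambda>y. v - v * y powr (v - 1)) y :> v * (1 - v) * y powr (v - 2)"
      if "y \<in> {s..t}" for y
      using that assms(1) by (auto intro!: derivative_eq_intros simp: algebra_simps)
    show "0 \<le> v * (1 - v) * y powr (v - 2)" for y
      using assms(2) by simp
  qed simp
  then show ?thesis
    using assms(3) by (rule convex_on_le_max)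
qed

theorem theorem2p2:
  fixes A B :: "'a :: complex_hilbert_space \<Rightarrow>\<^sub>L 'a"
    and s t v :: real
  assumes "strictly_positive_op A" and "strictly_positive_op B"
    and "0 < s" and "s \<le> t"
    and "s *\<^sub>R A \<le>\<^sub>o\<^sub>p B" and "B \<le>\<^sub>o\<^sub>p t *\<^sub>R A"
    and "v \<in> {0..1}"
  shows "arith_mean_op v A B - geom_mean_op v A B \<le>\<^sub>o\<^sub>p max (g_fun v s) (g_fun v t) *\<^sub>R A"
proof -
  define m where "m = max (g_fun v s) (g_fun v t)"
  have B: "selfadjoint_op B" and "selfadjoint_op (s *\<^sub>R A)"
    using assms(5) by (simp_all add: le_op_def)
  then have A: "selfadjoint_op A"
    using selfadjoint_op_scaleR[of "s *\<^sub>R A" "1 / s"] assms(3) by simp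
  have lower: "s * inner (A x) x \<le> inner (B x) x" for x
    using assms(5) A B unfolding le_op_def
    by (simp add: positive_op_iff_inner selfadjoint_op_diff selfadjoint_op_scaleR
        blinfun.diff_left blinfun.scaleR_left inner_diff_left)
  have upper: "inner (B x) x \<le> t * inner (A x) x" for x
    using assms(6) A B unfolding le_op_def
    by (simp add: positive_op_iff_inner selfadjoint_op_diff selfadjoint_op_scaleR
        blinfun.diff_left blinfun.scaleR_left inner_diff_left)
  define R where "R = powr_op A (1/2)"
  define Q where "Q = powr_op A (- 1/2)"
  note roots = strictly_positive_op_roots[OF assms(1) A, folded R_def Q_def]
  have RR: "R (R x) = A x" and RQ: "R (Q x) = x" and QR: "Q (R x) = x" for x
    using roots(3-5) by (metis blinfun_apply_blinfun_compose id_blinfun.rep_eq id_apply)+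
  define T where "T = Q o\<^sub>L B o\<^sub>L Q"
  have T: "selfadjoint_op T"
    unfolding T_def by (intro selfadjoint_op_conjugate roots B)
  have TQ: "inner (T x) x = inner (B (Q x)) (Q x)" for x
    by (simp add: T_def selfadjoint_op_inner[OF roots(2)])
  have AQ: "inner (A (Q x)) (Q x) = (norm x)\<^sup>2" for x
    using selfadjoint_op_inner[OF roots(1), of "R (Q x)" "Q x"]
    by (simp add: RR RQ power2_norm_eq_inner flip: RR[of "Q x"])
  have spec: "real_spectrum T \<subseteq> {s..t}"
    using lower[of "Q _"] upper[of "Q _"]
    by (intro real_spectrum_subset_interval selfadjoint_op_clinear T) (simp_all add: TQ AQ)
  have cont: "continuous_on {s..t} (\<lambda>x. x powr v)"
    using assms(3) by (intro continuous_intros) auto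
  define P where "P = powr_op T v"
  have P: "has_cfc (\<lambda>x. x powr v) T P"
    using has_cfc_exists[OF T spec cont] cfc_eqI[OF T] unfolding P_def powr_op_def by metis
  then have Psa: "selfadjoint_op P"
    by (rule has_cfc_selfadjoint[OF T])
  define G where "G = poly_op [:1 - v, v:] T - P"
  have "has_cfc (\<lambda>x. poly [:1 - v, v:] x - x powr v) T G"
    unfolding G_def by (intro has_cfc_diff has_cfc_poly P)
  then have G: "has_cfc (g_fun v) T G"
    by (simp add: g_fun_def[abs_def] mult.commute)
  have cont_g: "continuous_on {s..t} (g_fun v)"
    unfolding g_fun_def[abs_def] by (intro continuous_intros cont)
  have G_le: "inner (G x) x \<le> m * (norm x)\<^sup>2" for x
    unfolding m_def
    by (intro has_cfc_upper_bound[OF T G spec cont_g] g_fun_le_max assms)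
  have geom: "geom_mean_op v A B = R o\<^sub>L P o\<^sub>L R"
    by (simp add: geom_mean_op_def R_def P_def T_def Q_def)
  have "(arith_mean_op v A B - geom_mean_op v A B) x = R (G (R x))" for x
    by (simp add: geom arith_mean_op_def G_def T_def poly_op_pCons poly_op_0 RR RQ QR
        blinfun.diff_left blinfun.diff_right blinfun.add_left blinfun.add_right
        blinfun.scaleR_left blinfun.scaleR_right)
  then have quad: "inner ((arith_mean_op v A B - geom_mean_op v A B) x) x = inner (G (R x)) (R x)"
    for x
    by (simp add: selfadjoint_op_inner[OF roots(1)])
  have normR: "(norm (R x))\<^sup>2 = inner (A x) x" for x
    using selfadjoint_op_inner[OF roots(1), of "R x" x] by (simp add: RR power2_norm_eq_inner)
  have lhs: "selfadjoint_op (arith_mean_op v A B - geom_mean_op v A B)"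
    unfolding geom arith_mean_op_def
    by (intro selfadjoint_op_diff selfadjoint_op_add selfadjoint_op_scaleR
        selfadjoint_op_conjugate A B roots Psa)
  have rhs: "selfadjoint_op (m *\<^sub>R A)"
    by (intro selfadjoint_op_scaleR A)
  have "0 \<le> inner ((m *\<^sub>R A - (arith_mean_op v A B - geom_mean_op v A B)) x) x" for x
  proof -
    have "inner ((arith_mean_op v A B - geom_mean_op v A B) x) x \<le> m * inner (A x) x"
      using G_le[of "R x"] by (simp only: quad normR)
    then show ?thesis
      by (simp add: blinfun.diff_left[of "m *\<^sub>R A"] blinfun.scaleR_left inner_diff_left)
  qed
  then have "positive_op (m *\<^sub>R A - (arith_mean_op v A B - geom_mean_op v A B))"
    using positive_op_iff_inner[OF selfadjoint_op_diff[OF rhs lhs]] by blast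
  then show ?thesis
    unfolding le_op_def m_def[symmetric] using lhs rhs by blast
qed

end
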